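(* For every $n\ge 2$, the normalized volume of the flow polytope $\mathcal{F}_{\mathrm{Car}_{n+1}}(1,1,\ldots,1)$ of the caracol graph is $$\operatorname{vol}\mathcal{F}_{\mathrm{Car}_{n+1}}(1,1,\ldots,1)=C_{n-2}\cdot n^{n-2},$$ where $C_k=\frac{1}{k+1}\binom{2k}{k}$.
   Context: The caracol graph $\mathrm{Car}_{n+1}$ is the directed graph on $\{1,\ldots,n+1\}$ with edges $(1,j)$ for $2\le j\le n$, $(i,i+1)$ for $2\le i\le n$, and $(i,n+1)$ for $2\le i\le n-1$ (so $m=3n-4$ edges). For a connected directed graph $G$ on $[n+1]$ with $m$ edges, each directed from smaller to larger vertex, and $\mathbf{a}\in\mathbb{Z}^n$, the flow polytope $\mathcal{F}_G(\mathbf{a})\subset\mathbb{R}^m$ is the set of tuples $(b_e)_{e\in E(G)}$ of nonnegative reals such that for each $j=1,\ldots,n$, (sum of $b_e$ over edges leaving $j$) minus (sum of $b_e$ over edges entering $j$) equals $a_j$. It lies in an affine subspace of dimension $m-n$, and $\operatorname{vol}$ is normalized volume: $(m-n)!$ times the $(m-n)$-dimensional volume, normalized so that a fundamental cell of the lattice of integer points of the linear subspace parallel to this affine subspace has volume $1$. *)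

theory Defs
  imports "HOL-Analysis.Analysis"
begin

text \<open>
  Directed graphs on the vertex set \<open>{1..n+1}\<close> without multiple edges are given by their
  edge set \<open>E :: (nat \<times> nat) set\<close>. The space of real vectors indexed by a finite set \<open>E\<close> is
  represented by the extensional functions \<open>E \<rightarrow>\<^sub>E UNIV\<close>.
\<close>

section \<open>Normalized volume\<close>

definition direction_space :: "'e set \<Rightarrow> ('e \<Rightarrow> real) set \<Rightarrow> ('e \<Rightarrow> real) set" where
  "direction_space E A = {(\<lambda>e\<in>E. x e - y e) |x y. x \<in> A \<and> y \<in> A}"

definition integer_points :: "'e set \<Rightarrow> ('e \<Rightarrow> real) set \<Rightarrow> ('e \<Rightarrow> real) set" where
  "integer_points E L = {x \<in> L. \<forall>e\<in>E. x e \<in> \<int>}"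

definition is_lattice_basis ::
  "'e set \<Rightarrow> nat \<Rightarrow> ('e \<Rightarrow> real) set \<Rightarrow> (nat \<Rightarrow> 'e \<Rightarrow> real) \<Rightarrow> bool" where
  "is_lattice_basis E d \<Lambda> v \<longleftrightarrow>
     (\<forall>i<d. v i \<in> \<Lambda>) \<and>
     (\<forall>x\<in>\<Lambda>. \<exists>!c :: nat \<Rightarrow> int.
        c \<in> {..<d} \<rightarrow>\<^sub>E UNIV \<and> x = (\<lambda>e\<in>E. \<Sum>i<d. of_int (c i) * v i e))"

definition affine_param ::
  "'e set \<Rightarrow> nat \<Rightarrow> ('e \<Rightarrow> real) \<Rightarrow> (nat \<Rightarrow> 'e \<Rightarrow> real) \<Rightarrow> (nat \<Rightarrow> real) \<Rightarrow> 'e \<Rightarrow> real" where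
  "affine_param E d p v t = (\<lambda>e\<in>E. p e + (\<Sum>i<d. t i * v i e))"

text \<open>
  The volume of \<open>P\<close> inside an affine subspace \<open>A\<close> of dimension \<open>d\<close> is the Lebesgue measure of
  \<open>P\<close> in the coordinates given by an origin \<open>p \<in> A\<close> and a \<open>\<int>\<close>-basis \<open>v\<close> of the lattice of integer
  points of the linear subspace parallel to \<open>A\<close>, so that the cell spanned by \<open>v\<close> has volume 1.
  The value does not depend on \<open>p\<close> and \<open>v\<close>. For \<open>d = 0\<close> the product measure is the point mass
  of total mass 1.
\<close>

definition lattice_volume ::
  "'e set \<Rightarrow> nat \<Rightarrow> ('e \<Rightarrow> real) set \<Rightarrow> ('e \<Rightarrow> real) set \<Rightarrow> real" where
  "lattice_volume E d A P =
     (let p = (SOME p. p \<in> A);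
          v = (SOME v. is_lattice_basis E d (integer_points E (direction_space E A)) v)
      in measure (\<Pi>\<^sub>M i\<in>{..<d}. lborel)
           {t \<in> {..<d} \<rightarrow>\<^sub>E UNIV. affine_param E d p v t \<in> P})"

definition normalized_volume ::
  "'e set \<Rightarrow> nat \<Rightarrow> ('e \<Rightarrow> real) set \<Rightarrow> ('e \<Rightarrow> real) set \<Rightarrow> real" where
  "normalized_volume E d A P = fact d * lattice_volume E d A P"

section \<open>Flow polytopes\<close>

definition net_flow :: "(nat \<times> nat) set \<Rightarrow> (nat \<times> nat \<Rightarrow> real) \<Rightarrow> nat \<Rightarrow> real" where
  "net_flow E b j = (\<Sum>e\<in>{e\<in>E. fst e = j}. b e) - (\<Sum>e\<in>{e\<in>E. snd e = j}. b e)"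

definition flow_space ::
  "nat \<Rightarrow> (nat \<times> nat) set \<Rightarrow> (nat \<Rightarrow> int) \<Rightarrow> (nat \<times> nat \<Rightarrow> real) set" where
  "flow_space n E a = {b \<in> E \<rightarrow>\<^sub>E UNIV. \<forall>j\<in>{1..n}. net_flow E b j = of_int (a j)}"

definition flow_polytope ::
  "nat \<Rightarrow> (nat \<times> nat) set \<Rightarrow> (nat \<Rightarrow> int) \<Rightarrow> (nat \<times> nat \<Rightarrow> real) set" where
  "flow_polytope n E a = {b \<in> flow_space n E a. \<forall>e\<in>E. b e \<ge> 0}"

text \<open>For a connected graph \<open>E\<close> on \<open>{1..n+1}\<close> the flow space has dimension \<open>card E - n\<close>.\<close>

definition flow_polytope_volume :: "nat \<Rightarrow> (nat \<times> nat) set \<Rightarrow> (nat \<Rightarrow> int) \<Rightarrow> real" where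
  "flow_polytope_volume n E a =
     normalized_volume E (card E - n) (flow_space n E a) (flow_polytope n E a)"

section \<open>The caracol graph\<close>

text \<open>\<open>caracol n\<close> is the edge set of the caracol graph on the \<open>n + 1\<close> vertices \<open>{1..n+1}\<close>.\<close>

definition caracol :: "nat \<Rightarrow> (nat \<times> nat) set" where
  "caracol n =
     {(1, j) |j. 2 \<le> j \<and> j \<le> n} \<union>
     {(i, i + 1) |i. 2 \<le> i \<and> i \<le> n} \<union>
     {(i, n + 1) |i. 2 \<le> i \<and> i \<le> n - 1}"

definition catalan :: "nat \<Rightarrow> real" where
  "catalan k = 1 / (real k + 1) * real ((2 * k) choose k)"

end

theory Submission imports Defs begin

text \<open>
  The flows on the edges \<open>(1, j)\<close> and \<open>(j, j + 1)\<close> with \<open>2 \<le> j < n\<close> are integral coordinates on the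
  flow space. Run through the vertices \<open>2, 3, \<dots>, n - 1\<close>. If \<open>m\<close> of them are left, the path brings in a
  flow \<open>y\<close> and vertex \<open>1\<close> still has to send out \<open>r\<close>, the volume \<open>G\<^sub>m(y, r)\<close> of the remaining choices
  satisfies \<open>G\<^sub>m\<^sub>+\<^sub>1(y, r) = \<integral>\<^sub>0\<^sup>r K\<^sub>m(1 + x + y, r - x) dx\<close>, where \<open>K\<^sub>m\<close> is the antiderivative of \<open>G\<^sub>m\<close> in \<open>y\<close>.
  The solution is \<open>K\<^sub>m(y, r) = y r\<^sup>m (y + r + m + 1)\<^sup>m / (m! (m + 1)!)\<close>: the last factor is constant along
  the path of integration, so that the recursion is elementary. The volume is \<open>G\<^sub>n\<^sub>-\<^sub>2(0, 1)\<close>.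
\<close>

section \<open>Lattice automorphisms preserve Lebesgue measure\<close>

abbreviation leb :: "'i set \<Rightarrow> ('i \<Rightarrow> real) measure" where
  "leb I \<equiv> \<Pi>\<^sub>M i\<in>I. lborel"

text \<open>Restricting the sum to \<open>I\<close> keeps it extensional, so it is a point of
  \<open>leb I\<close> even for arguments such as \<open>\<lambda>i. - z i\<close> that are not
  extensional.\<close>

definition vadd :: "'i set \<Rightarrow> ('i \<Rightarrow> real) \<Rightarrow> ('i \<Rightarrow> real) \<Rightarrow> 'i \<Rightarrow> real" where
  "vadd I x y = (\<lambda>i\<in>I. x i + y i)"

interpretation leb: product_sigma_finite "\<lambda>_::'i. lborel :: real measure"
  by standard

lemma space_leb: "space (leb I) = I \<rightarrow>\<^sub>E UNIV"
  by (simp add: space_PiM)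

lemma vadd_commute: "vadd I x y = vadd I y x"
  by (simp add: vadd_def add.commute)

lemma measurable_vadd [measurable]:
  assumes [measurable]: "f \<in> N \<rightarrow>\<^sub>M leb I" "g \<in> N \<rightarrow>\<^sub>M leb I"
  shows "(\<lambda>x. vadd I (f x) (g x)) \<in> N \<rightarrow>\<^sub>M leb I"
proof -
  have "(\<lambda>x. f x i) \<in> borel_measurable N" "(\<lambda>x. g x i) \<in> borel_measurable N" if "i \<in> I" for i
    using assms[THEN measurable_compose[OF _ measurable_component_singleton[OF that]]] by simp_all
  then show ?thesis
    unfolding vadd_def by (intro measurable_restrict) auto
qed

lemma measurable_vadd_const [measurable]:
  assumes [measurable]: "g \<in> N \<rightarrow>\<^sub>M leb I"
  shows "(\<lambda>x. vadd I a (g x)) \<in> N \<rightarrow>\<^sub>M leb I"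
proof -
  have "(\<lambda>x. vadd I a (g x)) = (\<lambda>x. vadd I (restrict a I) (g x))"
    by (auto simp: vadd_def fun_eq_iff)
  also have "\<dots> \<in> N \<rightarrow>\<^sub>M leb I"
    by (intro measurable_vadd measurable_const assms) (auto simp: space_PiM)
  finally show ?thesis .
qed

lemma measurable_vadd_const_right [measurable]:
  assumes [measurable]: "g \<in> N \<rightarrow>\<^sub>M leb I"
  shows "(\<lambda>x. vadd I (g x) a) \<in> N \<rightarrow>\<^sub>M leb I"
  by (subst vadd_commute) (rule measurable_vadd_const[OF assms])

lemma vadd_assoc: "vadd I (vadd I x y) z = vadd I x (vadd I y z)"
  by (auto simp: vadd_def add.assoc)

text \<open>A product measure is determined by its values on boxes, and the preimage of a box is
  again a box whose sides are translated one by one. This reduces the claim to the invariance of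
  \<open>lborel\<close>.\<close>

lemma distr_leb_translation:
  assumes "finite I"
  shows "distr (leb I) (leb I) (vadd I a) = leb I"
proof (rule leb.PiM_eqI[OF assms])
  fix A :: "'a \<Rightarrow> real set" assume A: "\<And>i. i \<in> I \<Longrightarrow> A i \<in> sets lborel"
  have vim: "(+) c -` B \<in> sets lborel" if "B \<in> sets lborel" for B and c :: real
    using that measurable_sets[of "(+) c" lborel lborel B] by simp
  have "vadd I a -` (Pi\<^sub>E I A) \<inter> space (leb I) = Pi\<^sub>E I (\<lambda>i. (+) (a i) -` A i)"
    by (auto simp: space_PiM vadd_def PiE_iff extensional_def)
  then have "emeasure (distr (leb I) (leb I) (vadd I a)) (Pi\<^sub>E I A)
      = emeasure (leb I) (Pi\<^sub>E I (\<lambda>i. (+) (a i) -` A i))"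
    using A assms by (subst emeasure_distr) (auto intro!: sets_PiM_I_finite)
  also have "\<dots> = (\<Prod>i\<in>I. emeasure lborel ((+) (a i) -` A i))"
    using A assms vim by (subst leb.emeasure_PiM) auto
  also have "\<dots> = (\<Prod>i\<in>I. emeasure lborel (A i))"
  proof (rule prod.cong[OF refl])
    fix i assume i: "i \<in> I"
    have "emeasure lborel (A i) = emeasure (distr lborel borel ((+) (a i))) (A i)"
      by (simp add: lborel_distr_plus)
    also have "\<dots> = emeasure lborel ((+) (a i) -` A i)"
      using A[OF i] by (subst emeasure_distr) auto
    finally show "emeasure lborel ((+) (a i) -` A i) = emeasure lborel (A i)" ..
  qed
  finally show "emeasure (distr (leb I) (leb I) (vadd I a)) (Pi\<^sub>E I A)
      = (\<Prod>i\<in>I. emeasure lborel (A i))" .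
qed simp

lemma nn_integral_leb_translation:
  assumes "finite I" and [measurable]: "f \<in> borel_measurable (leb I)"
  shows "(\<integral>\<^sup>+x. f (vadd I a x) \<partial>leb I) = (\<integral>\<^sup>+x. f x \<partial>leb I)"
proof -
  have "(\<integral>\<^sup>+x. f x \<partial>leb I) = (\<integral>\<^sup>+x. f x \<partial>distr (leb I) (leb I) (vadd I a))"
    by (simp add: distr_leb_translation assms(1))
  also have "\<dots> = (\<integral>\<^sup>+x. f (vadd I a x) \<partial>leb I)"
    by (subst nn_integral_distr) auto
  finally show ?thesis ..
qed

section \<open>Tiling of space by the integer translates of the unit cell\<close>

abbreviation unit_cell :: "'i set \<Rightarrow> ('i \<Rightarrow> real) set" where
  "unit_cell I \<equiv> I \<rightarrow>\<^sub>E {0..<1}"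

abbreviation int_lattice :: "'i set \<Rightarrow> ('i \<Rightarrow> real) set" where
  "int_lattice I \<equiv> I \<rightarrow>\<^sub>E \<int>"

lemma countable_int_lattice: "finite I \<Longrightarrow> countable (int_lattice I)"
  by (intro countable_PiE) (auto simp: Ints_def)

lemma unit_cell_sets [measurable]: "finite I \<Longrightarrow> unit_cell I \<in> sets (leb I)"
  by (intro sets_PiM_I_finite) auto

lemma emeasure_unit_cell: "finite I \<Longrightarrow> emeasure (leb I) (unit_cell I) = 1"
  by (subst leb.emeasure_PiM) auto

text \<open>The cell is half-open, so each point lies in exactly one translate, the one at the
  vector of floors of its coordinates.\<close>

lemma unit_cell_translates:
  assumes "finite I" and x: "x \<in> I \<rightarrow>\<^sub>E UNIV"
  shows "(\<integral>\<^sup>+z. indicator (unit_cell I) (vadd I (\<lambda>i. - z i) x) \<partial>count_space (int_lattice I)) = (1::ennreal)"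
proof -
  define z0 where "z0 = (\<lambda>i\<in>I. of_int \<lfloor>x i\<rfloor> :: real)"
  have z0: "z0 \<in> int_lattice I" by (auto simp: z0_def)
  have iff: "vadd I (\<lambda>i. - z i) x \<in> unit_cell I \<longleftrightarrow> z = z0" if "z \<in> int_lattice I" for z
  proof
    assume *: "vadd I (\<lambda>i. - z i) x \<in> unit_cell I"
    show "z = z0"
    proof (rule PiE_ext[OF that z0])
      fix i assume i: "i \<in> I"
      then have "z i \<in> \<int>" using that by blast
      then obtain k where k: "z i = of_int k" by (auto elim!: Ints_cases)
      have "0 \<le> - z i + x i" "- z i + x i < 1"
        using PiE_mem[OF * i] i by (auto simp: vadd_def)
      then have "\<lfloor>x i\<rfloor> = k" unfolding k by (intro floor_unique) auto
      then show "z i = z0 i" using i k by (simp add: z0_def)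
    qed
  next
    assume "z = z0"
    then show "vadd I (\<lambda>i. - z i) x \<in> unit_cell I"
      by (auto simp: vadd_def z0_def) linarith
  qed
  have "(\<integral>\<^sup>+z. indicator (unit_cell I) (vadd I (\<lambda>i. - z i) x) \<partial>count_space (int_lattice I))
     = (\<integral>\<^sup>+z. indicator {z0} z \<partial>count_space (int_lattice I))"
    by (intro nn_integral_cong) (auto simp: indicator_def iff)
  also have "\<dots> = 1" using z0 by (subst nn_integral_indicator) auto
  finally show ?thesis .
qed

text \<open>Multiply the integrand by the sum of the indicators of all tiles, which is 1, exchange
  the countable sum with the integral, and translate each tile back to the cell.\<close>

lemma nn_integral_leb_tiling:
  assumes "finite I" and [measurable]: "f \<in> borel_measurable (leb I)"
  shows "(\<integral>\<^sup>+x. f x \<partial>leb I) =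
    (\<integral>\<^sup>+z. \<integral>\<^sup>+x. f (vadd I z x) * indicator (unit_cell I) x \<partial>leb I \<partial>count_space (int_lattice I))"
proof -
  note [measurable] = unit_cell_sets[OF assms(1)]
  have "(\<integral>\<^sup>+x. f x \<partial>leb I) = (\<integral>\<^sup>+x. \<integral>\<^sup>+z. f x * indicator (unit_cell I) (vadd I (\<lambda>i. - z i) x)
      \<partial>count_space (int_lattice I) \<partial>leb I)"
    by (intro nn_integral_cong) (simp add: nn_integral_cmult unit_cell_translates assms space_leb)
  also have "\<dots> = (\<integral>\<^sup>+z. \<integral>\<^sup>+x. f x * indicator (unit_cell I) (vadd I (\<lambda>i. - z i) x)
      \<partial>leb I \<partial>count_space (int_lattice I))"
    by (intro nn_integral_count_space_nn_integral countable_int_lattice assms) measurable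
  also have "\<dots> = (\<integral>\<^sup>+z. \<integral>\<^sup>+x. f (vadd I z x) * indicator (unit_cell I) x
      \<partial>leb I \<partial>count_space (int_lattice I))"
  proof (rule nn_integral_cong)
    fix z :: "'a \<Rightarrow> real"
    have "(\<integral>\<^sup>+x. f x * indicator (unit_cell I) (vadd I (\<lambda>i. - z i) x) \<partial>leb I)
      = (\<integral>\<^sup>+x. f (vadd I z x) * indicator (unit_cell I) (vadd I (\<lambda>i. - z i) (vadd I z x)) \<partial>leb I)"
      by (rule nn_integral_leb_translation[symmetric]) (use assms in measurable)
    also have "\<dots> = (\<integral>\<^sup>+x. f (vadd I z x) * indicator (unit_cell I) x \<partial>leb I)"
    proof (rule nn_integral_cong)
      fix x assume "x \<in> space (leb I)"
      then have "vadd I (\<lambda>i. - z i) (vadd I z x) = x"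
        by (auto simp: space_leb vadd_def fun_eq_iff PiE_iff extensional_def)
      then show "f (vadd I z x) * indicator (unit_cell I) (vadd I (\<lambda>i. - z i) (vadd I z x))
        = f (vadd I z x) * indicator (unit_cell I) x" by simp
    qed
    finally show "(\<integral>\<^sup>+x. f x * indicator (unit_cell I) (vadd I (\<lambda>i. - z i) x) \<partial>leb I)
      = (\<integral>\<^sup>+x. f (vadd I z x) * indicator (unit_cell I) x \<partial>leb I)" .
  qed
  finally show ?thesis .
qed

text \<open>
  The integral of \<open>f \<circ> T\<close> does not change if \<open>f\<close> is translated by \<open>y\<close>. Averaging over all \<open>y\<close> in the
  unit cell and tiling the domain, one finds for each point \<open>x\<close> of the cell the integral of \<open>f\<close> over
  the tiling of the codomain, translated by \<open>T x\<close>. So no determinant is needed.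
\<close>

lemma nn_integral_leb_lattice_automorphism:
  assumes I: "finite I"
    and [measurable]: "T \<in> leb I \<rightarrow>\<^sub>M leb I" "f \<in> borel_measurable (leb I)"
    and add: "\<And>x y. x \<in> I \<rightarrow>\<^sub>E UNIV \<Longrightarrow> y \<in> I \<rightarrow>\<^sub>E UNIV \<Longrightarrow> T (vadd I x y) = vadd I (T x) (T y)"
    and surj: "T ` (I \<rightarrow>\<^sub>E UNIV) = I \<rightarrow>\<^sub>E UNIV"
    and bij: "bij_betw T (int_lattice I) (int_lattice I)"
  shows "(\<integral>\<^sup>+x. f (T x) \<partial>leb I) = (\<integral>\<^sup>+x. f x \<partial>leb I)"
proof -
  let ?Q = "unit_cell I" and ?Z = "int_lattice I"
  note [measurable] = unit_cell_sets[OF I]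
  interpret S: pair_sigma_finite "leb I" "leb I"
    by (intro pair_sigma_finite.intro leb.sigma_finite I)
  have unit: "(\<integral>\<^sup>+y. c * indicator ?Q y \<partial>leb I) = c" for c
    by (simp add: nn_integral_cmult_indicator emeasure_unit_cell I)
  \<comment> \<open>Surjectivity gives \<open>y = T y'\<close>. Translating by \<open>y'\<close>,
    tiling the domain and replacing \<open>T z\<close> by \<open>z\<close>, since \<open>T\<close>
    permutes the lattice, leads to the right-hand side.\<close>
  have shift: "(\<integral>\<^sup>+x. f (T x) \<partial>leb I) = (\<integral>\<^sup>+z. \<integral>\<^sup>+x. f (vadd I (vadd I (T x) z) y) * indicator ?Q x
      \<partial>leb I \<partial>count_space ?Z)"
    if y: "y \<in> I \<rightarrow>\<^sub>E UNIV" for y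
  proof -
    have "y \<in> T ` (I \<rightarrow>\<^sub>E UNIV)" using y surj by simp
    then obtain y' where y': "y' \<in> I \<rightarrow>\<^sub>E UNIV" "T y' = y" by (elim imageE) simp
    have "(\<integral>\<^sup>+x. f (T x) \<partial>leb I) = (\<integral>\<^sup>+x. f (T (vadd I y' x)) \<partial>leb I)"
      by (rule nn_integral_leb_translation[symmetric, where f = "\<lambda>x. f (T x)"]) (use I in measurable)
    also have "\<dots> = (\<integral>\<^sup>+x. f (vadd I (T x) y) \<partial>leb I)"
      by (intro nn_integral_cong) (simp add: add y' space_leb vadd_commute)
    also have "\<dots> = (\<integral>\<^sup>+z. \<integral>\<^sup>+x. f (vadd I (T (vadd I z x)) y) * indicator ?Q x \<partial>leb I \<partial>count_space ?Z)"
      by (rule nn_integral_leb_tiling) (use I in measurable)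
    also have "\<dots> = (\<integral>\<^sup>+z. \<integral>\<^sup>+x. f (vadd I (vadd I (T x) (T z)) y) * indicator ?Q x \<partial>leb I \<partial>count_space ?Z)"
    proof (intro nn_integral_cong)
      fix z x assume "z \<in> space (count_space ?Z)" "x \<in> space (leb I)"
      then have "z \<in> I \<rightarrow>\<^sub>E UNIV" "x \<in> I \<rightarrow>\<^sub>E UNIV" by (auto simp: space_leb PiE_iff)
      then show "f (vadd I (T (vadd I z x)) y) * indicator ?Q x
          = f (vadd I (vadd I (T x) (T z)) y) * indicator ?Q x"
        by (simp add: add vadd_commute)
    qed
    also have "\<dots> = (\<integral>\<^sup>+z. \<integral>\<^sup>+x. f (vadd I (vadd I (T x) z) y) * indicator ?Q x \<partial>leb I \<partial>count_space ?Z)"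
      by (rule nn_integral_bij_count_space[OF bij])
    finally show ?thesis .
  qed
  define g where "g z x y = f (vadd I (vadd I (T x) z) y) * indicator ?Q x * indicator ?Q y" for z x y
  have g2 [measurable]: "case_prod (g z) \<in> borel_measurable (leb I \<Otimes>\<^sub>M leb I)" for z
    unfolding g_def by measurable
  have g2' [measurable]: "(\<lambda>(y, x). g z x y) \<in> borel_measurable (leb I \<Otimes>\<^sub>M leb I)" for z
    unfolding g_def by measurable
  \<comment> \<open>The cell has measure 1, so averaging over \<open>y\<close> leaves the value
    unchanged.\<close>
  have "(\<integral>\<^sup>+x. f (T x) \<partial>leb I) = (\<integral>\<^sup>+y. (\<integral>\<^sup>+x. f (T x) \<partial>leb I) * indicator ?Q y \<partial>leb I)"
    by (simp add: unit)
  also have "\<dots> = (\<integral>\<^sup>+y. \<integral>\<^sup>+z. \<integral>\<^sup>+x. g z x y \<partial>leb I \<partial>count_space ?Z \<partial>leb I)"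
  proof (rule nn_integral_cong)
    fix y assume y: "y \<in> space (leb I)"
    then have y': "y \<in> I \<rightarrow>\<^sub>E UNIV" by (simp add: space_leb)
    note [measurable] = measurable_const[OF y]
    have "(\<integral>\<^sup>+x. f (T x) \<partial>leb I) * indicator ?Q y
      = (\<integral>\<^sup>+z. (\<integral>\<^sup>+x. f (vadd I (vadd I (T x) z) y) * indicator ?Q x \<partial>leb I) * indicator ?Q y \<partial>count_space ?Z)"
      by (subst shift[OF y'], subst nn_integral_multc) auto
    also have "\<dots> = (\<integral>\<^sup>+z. \<integral>\<^sup>+x. g z x y \<partial>leb I \<partial>count_space ?Z)"
      unfolding g_def by (intro nn_integral_cong nn_integral_multc[symmetric]) measurable
    finally show "(\<integral>\<^sup>+x. f (T x) \<partial>leb I) * indicator ?Q y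
      = (\<integral>\<^sup>+z. \<integral>\<^sup>+x. g z x y \<partial>leb I \<partial>count_space ?Z)" .
  qed
  \<comment> \<open>Three interchanges turn the order \<open>y\<close>, \<open>z\<close>,
    \<open>x\<close> into \<open>x\<close>, \<open>z\<close>, \<open>y\<close>. Now the sum over
    \<open>z\<close> and the cell integral over \<open>y\<close> form a tiling of the
    codomain.\<close>
  also have "\<dots> = (\<integral>\<^sup>+z. \<integral>\<^sup>+y. \<integral>\<^sup>+x. g z x y \<partial>leb I \<partial>leb I \<partial>count_space ?Z)"
    by (intro nn_integral_count_space_nn_integral countable_int_lattice I
        sigma_finite_measure.borel_measurable_nn_integral[OF leb.sigma_finite[OF I] g2'])
  also have "\<dots> = (\<integral>\<^sup>+z. \<integral>\<^sup>+x. \<integral>\<^sup>+y. g z x y \<partial>leb I \<partial>leb I \<partial>count_space ?Z)"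
    by (intro nn_integral_cong S.Fubini' g2)
  also have "\<dots> = (\<integral>\<^sup>+x. \<integral>\<^sup>+z. \<integral>\<^sup>+y. g z x y \<partial>leb I \<partial>count_space ?Z \<partial>leb I)"
    by (intro nn_integral_count_space_nn_integral[symmetric] countable_int_lattice I
        sigma_finite_measure.borel_measurable_nn_integral[OF leb.sigma_finite[OF I] g2])
  also have "\<dots> = (\<integral>\<^sup>+x. (\<integral>\<^sup>+y. f (vadd I (T x) y) \<partial>leb I) * indicator ?Q x \<partial>leb I)"
  proof (rule nn_integral_cong)
    fix x assume x: "x \<in> space (leb I)"
    have tile: "(\<integral>\<^sup>+y. f (vadd I (T x) y) \<partial>leb I)
      = (\<integral>\<^sup>+z. \<integral>\<^sup>+y. f (vadd I (T x) (vadd I z y)) * indicator ?Q y \<partial>leb I \<partial>count_space ?Z)"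
      by (rule nn_integral_leb_tiling[OF I]) measurable
    have "(\<integral>\<^sup>+z. \<integral>\<^sup>+y. g z x y \<partial>leb I \<partial>count_space ?Z) = (\<integral>\<^sup>+z. (\<integral>\<^sup>+y. f (vadd I (T x) (vadd I z y)) * indicator ?Q y \<partial>leb I)
       * indicator ?Q x \<partial>count_space ?Z)"
      unfolding g_def
      by (subst nn_integral_multc[symmetric], measurable)
         (simp add: vadd_assoc mult_ac)
    also have "\<dots> = (\<integral>\<^sup>+y. f (vadd I (T x) y) \<partial>leb I) * indicator ?Q x"
      by (subst tile, subst nn_integral_multc) auto
    finally show "(\<integral>\<^sup>+z. \<integral>\<^sup>+y. g z x y \<partial>leb I \<partial>count_space ?Z) = (\<integral>\<^sup>+y. f (vadd I (T x) y) \<partial>leb I) * indicator ?Q x" .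
  qed
  \<comment> \<open>By translation invariance the inner integral is independent of \<open>x\<close>,
    so only the average of a constant over the cell is left.\<close>
  also have "\<dots> = (\<integral>\<^sup>+x. f x \<partial>leb I)"
    by (simp add: nn_integral_leb_translation[OF I] unit)
  finally show ?thesis .
qed

section \<open>Lattice volume in integral coordinates\<close>

definition coords :: "nat \<Rightarrow> (nat \<Rightarrow> 'e) \<Rightarrow> ('e \<Rightarrow> real) \<Rightarrow> nat \<Rightarrow> real" where
  "coords d ed b = (\<lambda>i\<in>{..<d}. b (ed i))"

definition lin_comb :: "'e set \<Rightarrow> nat \<Rightarrow> (nat \<Rightarrow> real) \<Rightarrow> (nat \<Rightarrow> 'e \<Rightarrow> real) \<Rightarrow> 'e \<Rightarrow> real" where
  "lin_comb E d c v = (\<lambda>e\<in>E. \<Sum>i<d. c i * v i e)"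

lemma coords_lin_comb:
  assumes "\<And>i. i < d \<Longrightarrow> ed i \<in> E"
  shows "coords d ed (lin_comb E d c v) = (\<lambda>i\<in>{..<d}. \<Sum>k<d. c k * v k (ed i))"
  using assms by (auto simp: coords_def lin_comb_def fun_eq_iff)

text \<open>\<open>lattice_volume\<close> uses an origin and a basis picked by \<open>SOME\<close>,
  of which only the defining properties are known. Assumptions \<open>bij\<close> and
  \<open>int\<close> make the chosen edges integral coordinates on the direction space. The passage
  from any lattice basis to them then maps the integer lattice onto itself and preserves Lebesgue
  measure.\<close>

proposition lattice_volume_coordinates:
  assumes "A \<noteq> {}" and A_ext: "A \<subseteq> extensional E" and "P \<subseteq> A"
    and ed: "\<And>i. i < d \<Longrightarrow> ed i \<in> E"
    and affine: "\<And>p x. p \<in> A \<Longrightarrow> x \<in> direction_space E A \<Longrightarrow> (\<lambda>e\<in>E. p e + x e) \<in> A"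
    and linear: "\<And>c x. (\<And>i. i < d \<Longrightarrow> x i \<in> direction_space E A) \<Longrightarrow> lin_comb E d c x \<in> direction_space E A"
    and bij: "bij_betw (coords d ed) (direction_space E A) ({..<d} \<rightarrow>\<^sub>E UNIV)"
    and int: "\<And>x e. x \<in> direction_space E A \<Longrightarrow> coords d ed x \<in> int_lattice {..<d} \<Longrightarrow> e \<in> E \<Longrightarrow> x e \<in> \<int>"
    and meas [measurable]: "coords d ed ` P \<in> sets (leb {..<d})"
  shows "lattice_volume E d A P = measure (leb {..<d}) (coords d ed ` P)"
proof -
  let ?I = "{..<d}"
  define L where "L = direction_space E A"
  define \<Lambda> where "\<Lambda> = integer_points E L"
  note affine = affine[folded L_def] and linear = linear[folded L_def]
    and bij = bij[folded L_def] and int = int[folded L_def]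
  have L_inj: "x = y" if "x \<in> L" "y \<in> L" "\<And>i. i < d \<Longrightarrow> x (ed i) = y (ed i)" for x y
    using bij_betw_imp_inj_on[OF bij] that by (auto simp: inj_on_def coords_def intro!: restrict_ext)
  have L_surj: "\<exists>x\<in>L. coords d ed x = u" if "u \<in> ?I \<rightarrow>\<^sub>E UNIV" for u
    using bij_betw_imp_surj_on[OF bij] that by (metis imageE)
  have \<Lambda>I: "x \<in> \<Lambda>" if "x \<in> L" "coords d ed x \<in> int_lattice ?I" for x
    using int[OF that] that(1) by (auto simp: \<Lambda>_def integer_points_def)
  have \<Lambda>L: "x \<in> L" if "x \<in> \<Lambda>" for x using that by (auto simp: \<Lambda>_def integer_points_def)
  have \<Lambda>_int: "x e \<in> \<int>" if "x \<in> \<Lambda>" "e \<in> E" for x e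
    using that by (auto simp: \<Lambda>_def integer_points_def)
  \<comment> \<open>Without a basis \<open>SOME\<close> would say nothing. The preimages of the unit
    vectors under \<open>coords\<close> form one, and the coefficients of an integer point are its
    values on the chosen edges.\<close>
  have ex_basis: "\<exists>v. is_lattice_basis E d \<Lambda> v"
  proof -
    have "\<exists>x\<in>L. coords d ed x = (\<lambda>j\<in>?I. if j = i then 1 else 0)" for i by (rule L_surj) auto
    then obtain w where w: "\<And>i. w i \<in> L" "\<And>i. coords d ed (w i) = (\<lambda>j\<in>?I. if j = i then 1 else 0)"
      by metis
    have w_ed: "w i (ed j) = (if j = i then 1 else 0)" if "j < d" for i j
      using fun_cong[OF w(2)[of i], of j] that by (simp add: coords_def)
    have w\<Lambda>: "w i \<in> \<Lambda>" for i using w by (intro \<Lambda>I) auto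
    have ex1: "\<exists>!c :: nat \<Rightarrow> int. c \<in> ?I \<rightarrow>\<^sub>E UNIV \<and> x = (\<lambda>e\<in>E. \<Sum>i<d. of_int (c i) * w i e)"
      if x: "x \<in> \<Lambda>" for x
    proof (rule ex1I[of _ "\<lambda>i\<in>?I. \<lfloor>x (ed i)\<rfloor>"])
      define c where "c = (\<lambda>i\<in>?I. \<lfloor>x (ed i)\<rfloor>)"
      have c: "of_int (c i) = x (ed i)" if "i < d" for i
        using \<Lambda>_int[OF x ed[OF that]] that by (simp add: c_def)
      have "x = lin_comb E d (\<lambda>i. of_int (c i)) w"
      proof (rule L_inj[OF \<Lambda>L[OF x] linear])
        fix j assume j: "j < d"
        have "(\<Sum>i<d. real_of_int (c i) * w i (ed j)) = (\<Sum>i<d. if j = i then real_of_int (c i) else 0)"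
          using j by (intro sum.cong) (auto simp: w_ed)
        also have "\<dots> = x (ed j)" using j by (simp add: c)
        finally show "x (ed j) = lin_comb E d (\<lambda>i. of_int (c i)) w (ed j)"
          using ed[OF j] by (simp add: lin_comb_def)
      qed (rule w)
      moreover have "c \<in> ?I \<rightarrow>\<^sub>E UNIV" by (simp add: c_def)
      ultimately show "(\<lambda>i\<in>?I. \<lfloor>x (ed i)\<rfloor>) \<in> ?I \<rightarrow>\<^sub>E UNIV \<and>
        x = (\<lambda>e\<in>E. \<Sum>i<d. of_int ((\<lambda>i\<in>?I. \<lfloor>x (ed i)\<rfloor>) i) * w i e)"
        unfolding lin_comb_def c_def by blast
    next
      fix c :: "nat \<Rightarrow> int"
      assume c: "c \<in> ?I \<rightarrow>\<^sub>E UNIV \<and> x = (\<lambda>e\<in>E. \<Sum>i<d. of_int (c i) * w i e)"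
      have "x (ed j) = of_int (c j)" if j: "j < d" for j
      proof -
        have "x (ed j) = (\<Sum>i<d. real_of_int (c i) * w i (ed j))"
          using fun_cong[OF conjunct2[OF c], of "ed j"] ed[OF j] by simp
        also have "\<dots> = (\<Sum>i<d. if j = i then real_of_int (c i) else 0)"
          using j by (intro sum.cong) (auto simp: w_ed)
        finally show ?thesis using j by simp
      qed
      then show "c = (\<lambda>i\<in>?I. \<lfloor>x (ed i)\<rfloor>)"
        by (intro PiE_ext[OF conjunct1[OF c]]) auto
    qed
    have "is_lattice_basis E d \<Lambda> w"
      unfolding is_lattice_basis_def by (intro conjI allI impI ballI w\<Lambda> ex1)
    then show ?thesis by (rule exI[of _ w])
  qed
  define v where "v = (SOME v. is_lattice_basis E d \<Lambda> v)"
  have basis: "is_lattice_basis E d \<Lambda> v"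
    unfolding v_def by (rule someI_ex[OF ex_basis])
  have v\<Lambda>: "v i \<in> \<Lambda>" if "i < d" for i using basis that by (auto simp: is_lattice_basis_def)
  have comb_L: "lin_comb E d t v \<in> L" for t by (intro linear \<Lambda>L v\<Lambda>)
  define p where "p = (SOME p. p \<in> A)"
  have p: "p \<in> A" unfolding p_def some_in_eq by fact
  \<comment> \<open>the passage from coordinates with respect to \<open>v\<close> to edge coordinates, a lattice automorphism\<close>
  define T where "T t = coords d ed (lin_comb E d t v)" for t
  have T_eq: "T t = (\<lambda>i\<in>?I. \<Sum>k<d. t k * v k (ed i))" for t
    unfolding T_def by (rule coords_lin_comb[OF ed])
  have T_meas: "T \<in> leb ?I \<rightarrow>\<^sub>M leb ?I"
  proof -
    have [measurable]: "(\<lambda>t. t k) \<in> borel_measurable (leb ?I)" if "k < d" for k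
      using measurable_component_singleton[of k ?I "\<lambda>_. lborel"] that by simp
    show ?thesis unfolding T_eq by measurable
  qed
  have T_add: "T (vadd ?I x y) = vadd ?I (T x) (T y)" for x y
    by (auto simp: T_eq vadd_def fun_eq_iff algebra_simps sum.distrib intro!: sum.cong)
  have T_int: "bij_betw T (int_lattice ?I) (int_lattice ?I)"
  proof (rule bij_betwI')
    fix z z' assume z: "z \<in> int_lattice ?I" "z' \<in> int_lattice ?I"
    \<comment> \<open>Bases are defined with coefficients of type \<open>int\<close>, whereas points
      of \<open>int_lattice\<close> are real functions with integer values; floors translate between
      the two.\<close>
    have fl: "of_int ((\<lambda>i\<in>?I. \<lfloor>u i\<rfloor>) i) = u i" if "u \<in> int_lattice ?I" "i < d" for u :: "nat \<Rightarrow> real" and i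
      using PiE_mem[OF that(1), of i] that(2) by simp
    show "T z = T z' \<longleftrightarrow> z = z'"
    proof
      assume "T z = T z'"
      \<comment> \<open>Injectivity of \<open>coords\<close> makes the two combinations equal. They
        are a single integer point, whose integer coefficients are unique.\<close>
      then have eq: "lin_comb E d z v = lin_comb E d z' v"
        using bij_betw_imp_inj_on[OF bij] comb_L by (auto simp: T_def inj_on_def)
      define x where "x = lin_comb E d z v"
      have x\<Lambda>: "x \<in> \<Lambda>"
        using comb_L z \<Lambda>_int[OF v\<Lambda>] unfolding x_def \<Lambda>_def integer_points_def
        by (auto simp: lin_comb_def intro!: Ints_sum Ints_mult dest: PiE_mem)
      define C where "C c \<longleftrightarrow> c \<in> ?I \<rightarrow>\<^sub>E UNIV \<and> x = (\<lambda>e\<in>E. \<Sum>i<d. of_int (c i) * v i e)"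
        for c :: "nat \<Rightarrow> int"
      have C: "C (\<lambda>i\<in>?I. \<lfloor>u i\<rfloor>)" if "u \<in> int_lattice ?I" "x = lin_comb E d u v" for u
      proof -
        have "x = (\<lambda>e\<in>E. \<Sum>i<d. of_int ((\<lambda>i\<in>?I. \<lfloor>u i\<rfloor>) i) * v i e)"
          unfolding that(2) lin_comb_def
          by (intro restrict_ext sum.cong refl) (simp only: fl[OF that(1)] lessThan_iff)
        then show ?thesis unfolding C_def by (intro conjI) auto
      qed
      have "\<exists>!c. C c"
        using basis x\<Lambda> unfolding is_lattice_basis_def C_def by blast
      then have "(\<lambda>i\<in>?I. \<lfloor>z i\<rfloor>) = (\<lambda>i\<in>?I. \<lfloor>z' i\<rfloor>)"
        using C[OF z(1) x_def] C[OF z(2) x_def[unfolded eq]] by (elim ex1E) metis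
      then have "z i = z' i" if "i < d" for i
        using fl[OF z(1) that] fl[OF z(2) that] by metis
      then show "z = z'" using z by (intro PiE_ext[OF z]) auto
    qed simp
  next
    fix z assume z: "z \<in> int_lattice ?I"
    show "T z \<in> int_lattice ?I"
      using z \<Lambda>_int[OF v\<Lambda> ed] by (auto simp: T_eq intro!: Ints_sum Ints_mult dest: PiE_mem)
  next
    fix u assume u: "u \<in> int_lattice ?I"
    then have "u \<in> ?I \<rightarrow>\<^sub>E UNIV" by (auto simp: PiE_iff)
    then obtain x where x: "x \<in> L" "coords d ed x = u" using L_surj by blast
    then have "x \<in> \<Lambda>" using u by (intro \<Lambda>I) auto
    then obtain c :: "nat \<Rightarrow> int" where "x = (\<lambda>e\<in>E. \<Sum>i<d. of_int (c i) * v i e)"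
      using basis unfolding is_lattice_basis_def by blast
    then have "x = lin_comb E d (\<lambda>i\<in>?I. of_int (c i)) v" by (simp add: lin_comb_def)
    then have "u = T (\<lambda>i\<in>?I. of_int (c i))" using x(2) by (simp add: T_def)
    then show "\<exists>z\<in>int_lattice ?I. u = T z"
      by (intro bexI[of _ "\<lambda>i\<in>?I. of_int (c i)"]) auto
  qed
  \<comment> \<open>The basis property concerns integer coefficients only. Real surjectivity follows
    since the unit vectors have preimages in the lattice, which can be combined with real
    coefficients.\<close>
  have T_surj: "T ` (?I \<rightarrow>\<^sub>E UNIV) = ?I \<rightarrow>\<^sub>E UNIV"
  proof (intro equalityI subsetI)
    fix y :: "nat \<Rightarrow> real" assume y: "y \<in> ?I \<rightarrow>\<^sub>E UNIV"
    have "\<exists>z. T z = (\<lambda>i\<in>?I. if i = j then 1 else 0)" for j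
    proof -
      have "(\<lambda>i\<in>?I. if i = j then 1 else 0 :: real) \<in> int_lattice ?I" by auto
      then show ?thesis using bij_betw_imp_surj_on[OF T_int] by (metis imageE)
    qed
    then obtain z where z: "\<And>j. T (z j) = (\<lambda>i\<in>?I. if i = j then 1 else 0)" by metis
    have zT: "(\<Sum>k<d. z j k * v k (ed i)) = (if i = j then 1 else 0)" if "i < d" for i j
      using fun_cong[OF z[of j], of i] that by (simp add: T_eq)
    define t where "t = (\<lambda>k\<in>?I. \<Sum>j<d. y j * z j k)"
    have "T t i = y i" if i: "i < d" for i
    proof -
      have "T t i = (\<Sum>k<d. \<Sum>j<d. y j * (z j k * v k (ed i)))"
        using i by (simp add: T_eq t_def sum_distrib_right mult.assoc)
      also have "\<dots> = (\<Sum>j<d. y j * (\<Sum>k<d. z j k * v k (ed i)))"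
        by (subst sum.swap) (simp add: sum_distrib_left)
      also have "\<dots> = (\<Sum>j<d. if i = j then y j else 0)"
        using i by (intro sum.cong) (auto simp: zT)
      also have "\<dots> = y i" using i by simp
      finally show ?thesis .
    qed
    then have "T t = y" using y by (auto simp: fun_eq_iff T_eq PiE_iff extensional_def)
    then show "y \<in> T ` (?I \<rightarrow>\<^sub>E UNIV)" by (intro image_eqI[of _ _ t]) (auto simp: t_def)
  qed (auto simp: T_eq)
  define S where "S = coords d ed ` P"
  have [measurable]: "S \<in> sets (leb ?I)" unfolding S_def by (rule meas)
  \<comment> \<open>Membership in \<open>P\<close> can be read off the coordinates: two points of
    \<open>A\<close> with equal coordinates differ by a direction with zero coordinates, hence are
    equal.\<close>
  have S_iff: "affine_param E d p v t \<in> P \<longleftrightarrow> vadd ?I (coords d ed p) (T t) \<in> S" for t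
  proof -
    let ?a = "affine_param E d p v t"
    have "?a = (\<lambda>e\<in>E. p e + lin_comb E d t v e)"
      by (auto simp: affine_param_def lin_comb_def)
    then have aA: "?a \<in> A" using affine[OF p comb_L] by simp
    have coords_a: "coords d ed ?a = vadd ?I (coords d ed p) (T t)"
      using ed by (auto simp: T_eq affine_param_def coords_def vadd_def fun_eq_iff)
    have "?a \<in> P" if "coords d ed ?a = coords d ed b" "b \<in> P" for b
    proof -
      have bA: "b \<in> A" using that(2) \<open>P \<subseteq> A\<close> by blast
      have diff: "(\<lambda>e\<in>E. x e - y e) \<in> L" if "x \<in> A" "y \<in> A" for x y
        using that by (auto simp: L_def direction_space_def)
      have "(\<lambda>e\<in>E. ?a e - b e) = (\<lambda>e\<in>E. b e - b e)"
      proof (rule L_inj[OF diff[OF aA bA] diff[OF bA bA]])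
        fix i assume i: "i < d"
        then show "(\<lambda>e\<in>E. ?a e - b e) (ed i) = (\<lambda>e\<in>E. b e - b e) (ed i)"
          using fun_cong[OF that(1), of i] ed by (simp add: coords_def)
      qed
      then have "?a e = b e" if "e \<in> E" for e
        using that by (metis (mono_tags, lifting) diff_self eq_iff_diff_eq_0 restrict_apply')
      then have "?a = b" using aA bA A_ext by (intro extensionalityI[of _ E]) auto
      then show ?thesis using that by simp
    qed
    then show ?thesis by (auto simp: S_def coords_a[symmetric])
  qed
  have "emeasure (leb ?I) {t \<in> ?I \<rightarrow>\<^sub>E UNIV. affine_param E d p v t \<in> P}
     = (\<integral>\<^sup>+t. indicator {t \<in> ?I \<rightarrow>\<^sub>E UNIV. affine_param E d p v t \<in> P} t \<partial>leb ?I)"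
  proof (rule nn_integral_indicator[symmetric])
    have "{t \<in> ?I \<rightarrow>\<^sub>E UNIV. affine_param E d p v t \<in> P}
      = (\<lambda>t. vadd ?I (coords d ed p) (T t)) -` S \<inter> space (leb ?I)"
      by (auto simp: S_iff space_leb)
    also have "\<dots> \<in> sets (leb ?I)" by (rule measurable_sets) (use T_meas in measurable)
    finally show "{t \<in> ?I \<rightarrow>\<^sub>E UNIV. affine_param E d p v t \<in> P} \<in> sets (leb ?I)" .
  qed
  also have "\<dots> = (\<integral>\<^sup>+t. indicator S (vadd ?I (coords d ed p) (T t)) \<partial>leb ?I)"
    by (intro nn_integral_cong) (simp add: indicator_def S_iff space_leb)
  also have "\<dots> = (\<integral>\<^sup>+u. indicator S (vadd ?I (coords d ed p) u) \<partial>leb ?I)"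
    by (rule nn_integral_leb_lattice_automorphism[where f = "\<lambda>u. indicator S (vadd ?I (coords d ed p) u)",
          OF _ T_meas _ T_add T_surj T_int]) auto
  also have "\<dots> = (\<integral>\<^sup>+u. indicator S u \<partial>leb ?I)"
    by (rule nn_integral_leb_translation) auto
  also have "\<dots> = emeasure (leb ?I) S" by simp
  finally have "measure (leb ?I) {t \<in> ?I \<rightarrow>\<^sub>E UNIV. affine_param E d p v t \<in> P} = measure (leb ?I) S"
    by (simp add: measure_def)
  then show ?thesis
    by (simp add: lattice_volume_def S_def flip: L_def \<Lambda>_def p_def v_def)
qed

section \<open>Volume of the region of admissible flows\<close>

text \<open>The highest two coordinates belong to the current vertex: \<open>t (2*m)\<close> is the
  flow it gets from vertex 1 and \<open>t (2*m+1)\<close> the flow it passes along the path. Its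
  outflow is \<open>1 + t (2*m) + y\<close>, with 1 the net supply, and the excess over
  \<open>t (2*m+1)\<close> goes straight to the sink.\<close>

fun region :: "nat \<Rightarrow> real \<Rightarrow> real \<Rightarrow> (nat \<Rightarrow> real) \<Rightarrow> bool" where
  "region 0 y r t \<longleftrightarrow> True"
| "region (Suc m) y r t \<longleftrightarrow> 0 \<le> t (2*m) \<and> t (2*m) \<le> r \<and>
     0 \<le> t (2*m+1) \<and> t (2*m+1) \<le> 1 + t (2*m) + y \<and> region m (t (2*m+1)) (r - t (2*m)) t"

lemma region_cong: "(\<And>i. i < 2*m \<Longrightarrow> t i = t' i) \<Longrightarrow> region m y r t \<longleftrightarrow> region m y r t'"
  by (induction m arbitrary: y r) auto

text \<open>Unfolds the recursion. As all summands are nonnegative, the successive bounds by the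
  remaining supply amount to one bound on the total; \<open>r \<ge> 0\<close> is what this bound
  says when \<open>m = 0\<close>.\<close>

lemma region_iff:
  assumes "r \<ge> 0"
  shows "region m y r t \<longleftrightarrow>
    (\<forall>k<m. 0 \<le> t (2*k) \<and> 0 \<le> t (2*k+1) \<and>
       t (2*k+1) \<le> 1 + t (2*k) + (if Suc k = m then y else t (2*k+3))) \<and> (\<Sum>k<m. t (2*k)) \<le> r"
  using assms
proof (induction m arbitrary: y r)
  case (Suc m)
  \<comment> \<open>In the induction hypothesis the incoming path flow is \<open>t (2*m+1)\<close>,
    which is \<open>t (2*k+3)\<close> at the boundary index, so the case distinction there
    disappears.\<close>
  have "(if Suc k = m then t (2*m+1) else t (2*k+3)) = t (2*k+3)" for k
  proof (cases "Suc k = m")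
    case True
    then have "2*m+1 = 2*k+3" by simp
    then show ?thesis by metis
  qed simp
  then have "(\<forall>k<m. 0 \<le> t (2*k) \<and> 0 \<le> t (2*k+1) \<and>
       t (2*k+1) \<le> 1 + t (2*k) + (if Suc k = m then t (2*m+1) else t (2*k+3))) \<longleftrightarrow>
    (\<forall>k<m. 0 \<le> t (2*k) \<and> 0 \<le> t (2*k+1) \<and>
       t (2*k+1) \<le> 1 + t (2*k) + (if Suc k = Suc m then y else t (2*k+3)))"
    by auto
  moreover have "t (2*m) \<le> r" if "\<forall>k<m. 0 \<le> t (2*k)" "(\<Sum>k<Suc m. t (2*k)) \<le> r"
    using sum_nonneg[of "{..<m}" "\<lambda>k. t (2*k)"] that by auto
  ultimately show ?case
    using Suc.IH[of "r - t (2*m)" "t (2*m+1)"]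
    by (cases "t (2*m) \<le> r") (auto simp: less_Suc_eq algebra_simps)
qed simp

lemma measurable_region_step:
  fixes a b f g :: "'a \<Rightarrow> real"
  assumes [measurable]: "a \<in> borel_measurable M" "b \<in> borel_measurable M" "f \<in> borel_measurable M"
    "g \<in> borel_measurable M" "Measurable.pred M h"
  shows "Measurable.pred M (\<lambda>t. 0 \<le> a t \<and> a t \<le> g t \<and> 0 \<le> b t \<and> b t \<le> 1 + a t + f t \<and> h t)"
  by measurable

text \<open>Both parameters may depend on \<open>t\<close>, because the recursive call has
  \<open>t (2*m+1)\<close> and \<open>g t - t (2*m)\<close> in their places.\<close>

lemma measurable_region:
  assumes "{..<2*m} \<subseteq> I"
    and [measurable]: "f \<in> borel_measurable (leb I)" "g \<in> borel_measurable (leb I)"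
  shows "Measurable.pred (leb I) (\<lambda>t. region m (f t) (g t) t)"
  using assms
proof (induction m arbitrary: f g)
  case (Suc m)
  note [measurable] = Suc.prems(2,3)
  have "2*m \<in> I" "2*m+1 \<in> I" using Suc.prems(1) by auto
  then have [measurable]: "(\<lambda>t. t (2*m)) \<in> borel_measurable (leb I)"
    "(\<lambda>t. t (2*m+1)) \<in> borel_measurable (leb I)"
    using measurable_component_singleton[of _ I "\<lambda>_. lborel"] by simp_all
  have [measurable]: "Measurable.pred (leb I) (\<lambda>t. region m (t (2*m+1)) (g t - t (2*m)) t)"
  proof (rule Suc.IH)
    show "{..<2*m} \<subseteq> I" using Suc.prems(1) by auto
  qed measurable
  show ?case unfolding region.simps by (rule measurable_region_step; fact)
qed simp

text \<open>\<open>pre_vol\<close> and \<open>region_vol\<close> are the functions \<open>K\<^sub>m\<close> and \<open>G\<^sub>m\<close> of the introduction.\<close>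

definition pre_vol :: "nat \<Rightarrow> real \<Rightarrow> real \<Rightarrow> real" where
  "pre_vol m y r = y * r ^ m * (y + r + real m + 1) ^ m / (fact m * fact (Suc m))"

definition region_vol :: "nat \<Rightarrow> real \<Rightarrow> real \<Rightarrow> real" where
  "region_vol m y r = r ^ m * ((y + r + real m + 1) ^ m + y * (real m * (y + r + real m + 1) ^ (m - 1)))
     / (fact m * fact (Suc m))"

lemma region_vol_nonneg: "0 \<le> y \<Longrightarrow> 0 \<le> r \<Longrightarrow> 0 \<le> region_vol m y r"
  by (simp add: region_vol_def)

lemma pre_vol_nonneg: "0 \<le> y \<Longrightarrow> 0 \<le> r \<Longrightarrow> 0 \<le> pre_vol m y r"
  by (simp add: pre_vol_def)

section \<open>The two integrations of the volume recursion\<close>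

lemma has_real_derivative_pre_vol: "((\<lambda>y. pre_vol m y r) has_real_derivative region_vol m y r) (at y)"
  unfolding pre_vol_def region_vol_def
  by (rule derivative_eq_intros refl | simp)+ (simp add: algebra_simps add_divide_distrib)

lemma nn_integral_region_vol:
  assumes "0 \<le> c" "0 \<le> r"
  shows "(\<integral>\<^sup>+y. ennreal (region_vol m y r) * indicator {0..c} y \<partial>lborel) = ennreal (pre_vol m c r)"
proof -
  have "(\<integral>\<^sup>+y. ennreal (region_vol m y r) * indicator {0..c} y \<partial>lborel) = ennreal (pre_vol m c r - pre_vol m 0 r)"
    using assms by (intro nn_integral_FTC_Icc has_real_derivative_pre_vol region_vol_nonneg)
      (auto simp: region_vol_def)
  then show ?thesis by (simp add: pre_vol_def)
qed

lemma nn_integral_pre_vol: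
  assumes "0 \<le> y" "0 \<le> r"
  shows "(\<integral>\<^sup>+x. ennreal (pre_vol m (1 + x + y) (r - x)) * indicator {0..r} x \<partial>lborel)
    = ennreal (region_vol (Suc m) y r)"
proof -
  \<comment> \<open>The arguments \<open>1 + x + y\<close> and \<open>r - x\<close> have a sum
    independent of \<open>x\<close>, so this factor of \<open>pre_vol\<close> is constant. What
    remains is a linear function times a power of \<open>r - x\<close>, and integration by parts
    yields \<open>F\<close>.\<close>
  define K :: real where "K = (y + r + real m + 2) ^ m / (fact m * fact (Suc m))"
  define F where "F x = - K * ((1 + x + y) * (r - x) ^ (m+1) / (real m + 1)
      + (r - x) ^ (m+2) / ((real m + 1) * (real m + 2)))" for x
  have pv: "pre_vol m (1 + x + y) (r - x) = K * ((1 + x + y) * (r - x) ^ m)" for x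
    by (simp add: pre_vol_def K_def algebra_simps)
  have deriv: "(F has_real_derivative pre_vol m (1 + x + y) (r - x)) (at x)" for x
  proof -
    have "((\<lambda>x. (1 + x + y) * (r - x) ^ (m+1) / (real m + 1)) has_real_derivative
        (r - x) ^ (m+1) / (real m + 1) - (1 + x + y) * (r - x) ^ m) (at x)"
      by (rule derivative_eq_intros refl | simp)+ (simp add: field_simps)
    moreover have "((\<lambda>x. (r - x) ^ (m+2) / ((real m + 1) * (real m + 2))) has_real_derivative
        - ((r - x) ^ (m+1) / (real m + 1))) (at x)"
      by (rule derivative_eq_intros refl | simp)+ (auto simp: divide_simps)
    ultimately have "(F has_real_derivative - K * ((r - x) ^ (m+1) / (real m + 1) - (1 + x + y) * (r - x) ^ m
        + - ((r - x) ^ (m+1) / (real m + 1)))) (at x)"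
      unfolding F_def by (intro DERIV_cmult DERIV_add)
    then show ?thesis by (simp add: pv)
  qed
  have "(\<integral>\<^sup>+x. ennreal (pre_vol m (1 + x + y) (r - x)) * indicator {0..r} x \<partial>lborel) = ennreal (F r - F 0)"
    using assms by (intro nn_integral_FTC_Icc deriv pre_vol_nonneg) (auto simp: pre_vol_def)
  also have "F r - F 0 = K * (r ^ (m+1) * ((1 + y) * (real m + 2) + r) / ((real m + 1) * (real m + 2)))"
    by (simp add: F_def divide_simps) (simp add: algebra_simps)
  also have "\<dots> = region_vol (Suc m) y r"
  proof -
    \<comment> \<open>Taking out the common power leaves
      \<open>(y + r + m + 2) + (m + 1) * y\<close>, which equals
      \<open>(1 + y) * (m + 2) + r\<close>.\<close>
    have "(y + r + real (Suc m) + 1) ^ Suc m + y * (real (Suc m) * (y + r + real (Suc m) + 1) ^ m)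
      = (y + r + real m + 2) ^ m * ((1 + y) * (real m + 2) + r)"
      by (simp add: algebra_simps)
    then show ?thesis
      by (simp add: region_vol_def K_def divide_simps) (simp add: algebra_simps)
  qed
  finally show ?thesis .
qed

text \<open>Tonelli: the two highest coordinates are integrated last, and the inner integral over
  the others is given by the induction hypothesis.\<close>

proposition emeasure_region:
  assumes "0 \<le> y" "0 \<le> r"
  shows "emeasure (leb {..<2*m}) {t \<in> {..<2*m} \<rightarrow>\<^sub>E UNIV. region m y r t} = ennreal (region_vol m y r)"
  using assms
proof (induction m arbitrary: y r)
  case 0
  \<comment> \<open>With no coordinates left the space is a single point of mass 1, matching
    \<open>region_vol 0 y r = 1\<close>.\<close>
  have "{t :: nat \<Rightarrow> real. t \<in> {..<0} \<rightarrow>\<^sub>E UNIV} = {\<lambda>_. undefined}" by auto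
  then show ?case
    by (simp add: region_vol_def space_PiM_empty PiM_empty emeasure_count_space)
next
  case (Suc m)
  \<comment> \<open>Inserting \<open>2*m\<close> last makes it the outermost variable
    \<open>x\<close>; the bound on \<open>z\<close>, at index \<open>2*m+1\<close>, depends on
    \<open>x\<close>.\<close>
  let ?I = "{..<2*m}" and ?J = "insert (2*m+1) {..<2*m}"
  let ?K = "insert (2*m) ?J"
  have K: "{..<2 * Suc m} = ?K" by auto
  define R where "R m I y r = {t \<in> I \<rightarrow>\<^sub>E UNIV. region m y r t}" for m I y r
  have R_sets: "R m I y r \<in> sets (leb I)" if "{..<2*m} \<subseteq> I" for m I y r
    using measurable_region[OF that, of "\<lambda>_. y" "\<lambda>_. r"]
    by (simp add: R_def pred_def space_leb)
  have ind: "indicator (R (Suc m) ?K y r) (t(2*m+1 := z, 2*m := x))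
    = indicator {0..r} x * (indicator {0..1+x+y} z * indicator (R m ?I z (r - x)) t :: ennreal)"
    if t: "t \<in> ?I \<rightarrow>\<^sub>E UNIV" for t x z
  proof -
    have "t(2*m+1 := z, 2*m := x) \<in> ?K \<rightarrow>\<^sub>E UNIV" using t by (auto simp: PiE_iff extensional_def)
    moreover have "region m z (r - x) (t(2*m+1 := z, 2*m := x)) \<longleftrightarrow> region m z (r - x) t"
      by (rule region_cong) auto
    ultimately show ?thesis using t by (auto simp: R_def indicator_def)
  qed
  have ms: "(indicator (R (Suc m) ?K y r) :: _ \<Rightarrow> ennreal) \<in> borel_measurable (leb ?K)"
    by (intro borel_measurable_indicator R_sets) auto
  have "emeasure (leb ?K) (R (Suc m) ?K y r) = (\<integral>\<^sup>+t. indicator (R (Suc m) ?K y r) t \<partial>leb ?K)"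
    by (rule nn_integral_indicator[symmetric], rule R_sets) auto
  also have "\<dots> = (\<integral>\<^sup>+x. \<integral>\<^sup>+z. \<integral>\<^sup>+t. indicator (R (Suc m) ?K y r) (t(2*m+1 := z, 2*m := x)) \<partial>leb ?I \<partial>lborel \<partial>lborel)"
  proof -
    have upd: "(\<lambda>s. indicator (R (Suc m) ?K y r) (s(2*m := x)) :: ennreal) \<in> borel_measurable (leb ?J)" for x
      by (rule measurable_compose[OF measurable_fun_upd[of _ ?J] ms]) auto
    show ?thesis
      by (subst leb.product_nn_integral_insert_rev[OF _ _ ms], simp, simp)
         (intro nn_integral_cong leb.product_nn_integral_insert_rev upd; simp)
  qed
  also have "\<dots> = (\<integral>\<^sup>+x. \<integral>\<^sup>+z. \<integral>\<^sup>+t. indicator {0..r} x * (indicator {0..1+x+y} z * indicator (R m ?I z (r - x)) t)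
      \<partial>leb ?I \<partial>lborel \<partial>lborel)"
    by (intro nn_integral_cong ind) (simp add: space_leb)
  also have "\<dots> = (\<integral>\<^sup>+x. ennreal (pre_vol m (1 + x + y) (r - x)) * indicator {0..r} x \<partial>lborel)"
  proof (rule nn_integral_cong)
    fix x :: real
    have "(\<integral>\<^sup>+z. \<integral>\<^sup>+t. indicator {0..r} x * (indicator {0..1+x+y} z * indicator (R m ?I z (r - x)) t) \<partial>leb ?I \<partial>lborel)
      = (\<integral>\<^sup>+z. indicator {0..r} x * (indicator {0..1+x+y} z * emeasure (leb ?I) (R m ?I z (r - x))) \<partial>lborel)"
      using R_sets[of m ?I] by (intro nn_integral_cong) (simp add: nn_integral_cmult)
    also have "\<dots> = (\<integral>\<^sup>+z. indicator {0..r} x * (ennreal (region_vol m z (r - x)) * indicator {0..1+x+y} z) \<partial>lborel)"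
      \<comment> \<open>The indicators supply the sign conditions of the induction hypothesis,
        namely \<open>0 \<le> z\<close> and \<open>0 \<le> r - x\<close>.\<close>
      using Suc.IH by (intro nn_integral_cong) (auto simp: indicator_def R_def)
    also have "\<dots> = indicator {0..r} x * (\<integral>\<^sup>+z. ennreal (region_vol m z (r - x)) * indicator {0..1+x+y} z \<partial>lborel)"
      by (intro nn_integral_cmult) (auto simp: region_vol_def)
    also have "\<dots> = ennreal (pre_vol m (1 + x + y) (r - x)) * indicator {0..r} x"
    proof (cases "x \<in> {0..r}")
      case True
      then show ?thesis using Suc.prems by (subst nn_integral_region_vol) auto
    qed simp
    finally show "(\<integral>\<^sup>+z. \<integral>\<^sup>+t. indicator {0..r} x * (indicator {0..1+x+y} z * indicator (R m ?I z (r - x)) t) \<partial>leb ?I \<partial>lborel)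
      = ennreal (pre_vol m (1 + x + y) (r - x)) * indicator {0..r} x" .
  qed
  also have "\<dots> = ennreal (region_vol (Suc m) y r)"
    by (rule nn_integral_pre_vol[OF Suc.prems])
  finally show ?case by (simp only: R_def K)
qed

section \<open>Flows on the caracol graph\<close>

lemma net_flow_add: "net_flow E (\<lambda>e\<in>E. x e + y e) j = net_flow E x j + net_flow E y j"
  by (simp add: net_flow_def sum.distrib)

lemma net_flow_diff: "net_flow E (\<lambda>e\<in>E. x e - y e) j = net_flow E x j - net_flow E y j"
  by (simp add: net_flow_def sum_subtractf)

lemma net_flow_lin_comb: "net_flow E (lin_comb E d c v) j = (\<Sum>i<d. c i * net_flow E (v i) j)"
proof -
  have "(\<Sum>e\<in>{e \<in> E. P e}. \<Sum>i<d. c i * v i e) = (\<Sum>i<d. c i * (\<Sum>e\<in>{e \<in> E. P e}. v i e))" for P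
    by (subst sum.swap) (simp add: sum_distrib_left)
  then show ?thesis
    by (simp add: net_flow_def lin_comb_def sum_subtractf right_diff_distrib)
qed

text \<open>A real right-hand side \<open>c\<close> covers both uses: \<open>c = 1\<close> is the
  flow space in question and \<open>c = 0\<close> its direction space.\<close>

definition const_flows :: "nat \<Rightarrow> (nat \<times> nat) set \<Rightarrow> real \<Rightarrow> (nat \<times> nat \<Rightarrow> real) set" where
  "const_flows n E c = {b \<in> E \<rightarrow>\<^sub>E UNIV. \<forall>j\<in>{1..n}. net_flow E b j = c}"

lemma direction_space_const_flows:
  assumes "const_flows n E c \<noteq> {}"
  shows "direction_space E (const_flows n E c) = const_flows n E 0"
proof (intro equalityI subsetI)
  fix x assume x: "x \<in> const_flows n E 0"
  obtain p where p: "p \<in> const_flows n E c" using assms by blast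
  have "(\<lambda>e\<in>E. p e + x e) \<in> const_flows n E c"
    using x p by (simp add: const_flows_def net_flow_add)
  moreover have "x = (\<lambda>e\<in>E. (\<lambda>e\<in>E. p e + x e) e - p e)"
    using x by (auto simp: const_flows_def fun_eq_iff PiE_iff extensional_def)
  ultimately show "x \<in> direction_space E (const_flows n E c)"
    using p unfolding direction_space_def by blast
qed (auto simp: direction_space_def const_flows_def net_flow_diff)

section \<open>Edges and conservation equations of the caracol graph\<close>

lemma card_caracol:
  assumes "n \<ge> 2"
  shows "card (caracol n) = 3 * n - 4"
proof -
  let ?A = "Pair (1::nat) ` {2..n}" and ?B = "(\<lambda>i. (i, i + 1)) ` {2..n}" and ?C = "(\<lambda>i. (i, n + 1)) ` {2..n-1}"
  have "caracol n = ?A \<union> ?B \<union> ?C" by (auto simp: caracol_def)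
  moreover have "?A \<inter> ?B = {}" "(?A \<union> ?B) \<inter> ?C = {}" by auto
  moreover have "card ?A = n - 1" "card ?B = n - 1" "card ?C = n - 2"
    by (subst card_image; auto simp: inj_on_def)+
  ultimately show ?thesis using assms by (simp add: card_Un_disjoint del: One_nat_def)
qed

text \<open>The condition \<open>3 \<le> j\<close> prevents the edge \<open>(1, 2)\<close> from
  being counted twice: at vertex 2 the pair \<open>(j - 1, j)\<close> is the edge from vertex
  1.\<close>

definition inflow :: "(nat \<times> nat \<Rightarrow> real) \<Rightarrow> nat \<Rightarrow> real" where
  "inflow b j = b (1, j) + (if 3 \<le> j then b (j - 1, j) else 0)"

text \<open>Vertex \<open>n\<close> is separate because its path edge and its edge to the sink are
  the same edge \<open>(n, n + 1)\<close>.\<close>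

lemma net_flow_caracol:
  assumes "n \<ge> 2"
  shows "net_flow (caracol n) b 1 = (\<Sum>j=2..n. b (1, j))"
    and "2 \<le> j \<Longrightarrow> j < n \<Longrightarrow> net_flow (caracol n) b j = b (j, j + 1) + b (j, n + 1) - inflow b j"
    and "net_flow (caracol n) b n = b (n, n + 1) - inflow b n"
proof -
  have "{e \<in> caracol n. fst e = 1} = Pair 1 ` {2..n}" "{e \<in> caracol n. snd e = 1} = {}"
    by (auto simp: caracol_def)
  then show "net_flow (caracol n) b 1 = (\<Sum>j=2..n. b (1, j))"
    by (simp only: net_flow_def) (simp add: sum.reindex inj_on_def)
  have inflow: "(\<Sum>e\<in>{e \<in> caracol n. snd e = j}. b e) = inflow b j" if "2 \<le> j" "j \<le> n" for j
  proof -
    have "{e \<in> caracol n. snd e = j} = (if 3 \<le> j then {(1, j), (j - 1, j)} else {(1, j)})"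
      using that by (auto simp: caracol_def)
    then show ?thesis by (simp add: inflow_def)
  qed
  show "net_flow (caracol n) b j = b (j, j + 1) + b (j, n + 1) - inflow b j" if "2 \<le> j" "j < n"
  proof -
    have "{e \<in> caracol n. fst e = j} = {(j, j + 1), (j, n + 1)}"
      using that by (auto simp: caracol_def)
    then show ?thesis using that by (simp add: net_flow_def inflow)
  qed
  have "{e \<in> caracol n. fst e = n} = {(n, n + 1)}"
    using assms by (auto simp: caracol_def)
  then show "net_flow (caracol n) b n = b (n, n + 1) - inflow b n"
    using assms by (simp add: net_flow_def inflow)
qed

lemma const_flows_caracol_iff:
  assumes "n \<ge> 2"
  shows "b \<in> const_flows n (caracol n) c \<longleftrightarrow> b \<in> caracol n \<rightarrow>\<^sub>E UNIV \<and> (\<Sum>j=2..<n. b (1, j)) + b (1, n) = c \<and>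
    (\<forall>j\<in>{2..<n}. b (j, j + 1) + b (j, n + 1) - inflow b j = c) \<and> b (n, n + 1) - inflow b n = c"
proof -
  have "{1..n} = insert 1 (insert n {2..<n})" using assms by auto
  moreover have "(\<Sum>j=2..n. b (1, j)) = (\<Sum>j=2..<n. b (1, j)) + b (1, n)"
    using assms by (simp add: sum.last_plus add.commute)
  ultimately show ?thesis
    using assms by (auto simp: const_flows_def net_flow_caracol[OF assms] simp del: One_nat_def)
qed

text \<open>
  The free edges, listed so that the two edges chosen at vertex \<open>2\<close> come last; peeling off the
  last two coordinates then walks through the vertices from left to right.
\<close>

definition free_edge :: "nat \<Rightarrow> nat \<Rightarrow> nat \<times> nat" where
  "free_edge n i = (if even i then (1, n - 1 - i div 2) else (n - 1 - i div 2, n - i div 2))"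

text \<open>Here \<open>X l\<close> and \<open>Y l\<close> are the flows on \<open>(1, l)\<close>
  and \<open>(l, l + 1)\<close>, and each other edge is solved from a conservation equation:
  \<open>(1, n)\<close> at vertex 1, \<open>(j, n + 1)\<close> at vertex \<open>j\<close>,
  \<open>(n, n + 1)\<close> at vertex \<open>n\<close>. In \<open>2 * c\<close>, one
  \<open>c\<close> is the net flow of \<open>n\<close> and the other comes in through
  \<open>(1, n)\<close>.\<close>

definition flow_lift :: "nat \<Rightarrow> real \<Rightarrow> (nat \<Rightarrow> real) \<Rightarrow> nat \<times> nat \<Rightarrow> real" where
  "flow_lift n c t = (\<lambda>(i, j).
     let X = (\<lambda>l. t (2 * (n - 1 - l))); Y = (\<lambda>l. t (2 * (n - 1 - l) + 1)) in
     if i = 1 then (if j = n then c - (\<Sum>l=2..<n. X l) else X j)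
     else if i = n then 2 * c - (\<Sum>l=2..<n. X l) + (if 3 \<le> n then Y (n - 1) else 0)
     else if j = i + 1 then Y i
     else c + X i + (if 3 \<le> i then Y (i - 1) else 0) - Y i)"

section \<open>The flows on the free edges as integral coordinates\<close>

lemma free_edge_in: "i < 2 * (n - 2) \<Longrightarrow> free_edge n i \<in> caracol n"
  by (auto simp: free_edge_def caracol_def)

lemma caracol_cases:
  assumes "e \<in> caracol n" "n \<ge> 2"
  obtains j where "e = (1, j)" "2 \<le> j" "j < n" | "e = (1, n)" | j where "e = (j, j + 1)" "2 \<le> j" "j < n"
    | j where "e = (j, n + 1)" "2 \<le> j" "j < n" | "e = (n, n + 1)"
  using assms by (auto simp: caracol_def) (metis le_neq_implies_less | force)+

text \<open>The path edge into \<open>j\<close> starts at \<open>j - 1\<close>, so its index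
  contains \<open>n - 1 - (j - 1) = n - j\<close>; for \<open>j = n\<close> this is coordinate
  1.\<close>

lemma flow_lift_simps:
  assumes "n \<ge> 2"
  shows "2 \<le> j \<Longrightarrow> j < n \<Longrightarrow> flow_lift n c t (1, j) = t (2 * (n - 1 - j))"
    and "flow_lift n c t (1, n) = c - (\<Sum>l=2..<n. t (2 * (n - 1 - l)))"
    and "2 \<le> j \<Longrightarrow> j < n \<Longrightarrow> flow_lift n c t (j, j + 1) = t (2 * (n - 1 - j) + 1)"
    and "2 \<le> j \<Longrightarrow> j < n \<Longrightarrow> flow_lift n c t (j, n + 1) =
      c + t (2 * (n - 1 - j)) + (if 3 \<le> j then t (2 * (n - j) + 1) else 0) - t (2 * (n - 1 - j) + 1)"
    and "flow_lift n c t (n, n + 1) =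
      2 * c - (\<Sum>l=2..<n. t (2 * (n - 1 - l))) + (if 3 \<le> n then t 1 else 0)"
  using assms by (auto simp: flow_lift_def Let_def Suc_diff_Suc)

lemma flow_lift_in:
  assumes "n \<ge> 2"
  shows "restrict (flow_lift n c t) (caracol n) \<in> const_flows n (caracol n) c"
proof -
  define b where "b = restrict (flow_lift n c t) (caracol n)"
  have mem: "(1, n) \<in> caracol n" "(n, n + 1) \<in> caracol n"
    "2 \<le> j \<Longrightarrow> j < n \<Longrightarrow> (1, j) \<in> caracol n"
    "2 \<le> j \<Longrightarrow> j < n \<Longrightarrow> (j, j + 1) \<in> caracol n"
    "2 \<le> j \<Longrightarrow> j < n \<Longrightarrow> (j, n + 1) \<in> caracol n" for j
    using assms by (auto simp: caracol_def)
  have b: "b e = flow_lift n c t e" if "e \<in> caracol n" for e using that by (simp add: b_def)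
  note L = flow_lift_simps[OF assms]
  have Y: "b (j - 1, j) = t (2 * (n - j) + 1)" if "3 \<le> j" "j \<le> n" for j
    using b[OF mem(4)[of "j - 1"]] L(3)[of "j - 1"] that by simp
  have "inflow b j = t (2 * (n - 1 - j)) + (if 3 \<le> j then t (2 * (n - j) + 1) else 0)"
    if "2 \<le> j" "j < n" for j
    unfolding inflow_def b[OF mem(3)[OF that]] L(1)[OF that] using Y[of j] that by auto
  moreover have "inflow b n = c - (\<Sum>l=2..<n. t (2 * (n - 1 - l))) + (if 3 \<le> n then t 1 else 0)"
    unfolding inflow_def b[OF mem(1)] L(2) using Y[of n] by auto
  moreover have "(\<Sum>j=2..<n. b (1, j)) = (\<Sum>l=2..<n. t (2 * (n - 1 - l)))"
    by (intro sum.cong refl) (simp only: atLeastLessThan_iff b mem L(1))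
  moreover have "b \<in> caracol n \<rightarrow>\<^sub>E UNIV" by (simp add: b_def)
  ultimately have "b \<in> const_flows n (caracol n) c"
    unfolding const_flows_caracol_iff[OF assms]
    by (auto simp: b[OF mem(1)] b[OF mem(2)] b[OF mem(4)] b[OF mem(5)] L simp del: One_nat_def Suc_eq_plus1)
  then show ?thesis by (simp add: b_def)
qed

lemma coords_free_edge:
  assumes "2 \<le> j" "j < n"
  shows "coords (2 * (n - 2)) (free_edge n) b (2 * (n - 1 - j)) = b (1, j)"
    and "coords (2 * (n - 2)) (free_edge n) b (2 * (n - 1 - j) + 1) = b (j, j + 1)"
  using assms by (auto simp: coords_def free_edge_def)

text \<open>The conservation equations determine a flow from its values on the free edges; this is
  the injectivity of \<open>coords\<close>.\<close>

lemma flow_lift_coords: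
  assumes "n \<ge> 2" "b \<in> const_flows n (caracol n) c" "e \<in> caracol n"
  shows "flow_lift n c (coords (2 * (n - 2)) (free_edge n) b) e = b e"
proof -
  define t where "t = coords (2 * (n - 2)) (free_edge n) b"
  have X: "t (2 * (n - 1 - j)) = b (1, j)" and Y: "t (2 * (n - 1 - j) + 1) = b (j, j + 1)"
    if "2 \<le> j" "j < n" for j
    using coords_free_edge[OF that] by (simp_all add: t_def)
  have Y': "t (2 * (n - j) + 1) = b (j - 1, j)" if "3 \<le> j" "j \<le> n" for j
    using Y[of "j - 1"] that by simp
  have sum: "(\<Sum>l=2..<n. t (2 * (n - 1 - l))) = (\<Sum>l=2..<n. b (1, l))"
    by (intro sum.cong refl X) auto
  note L = flow_lift_simps[OF assms(1)]
  note B = assms(2)[unfolded const_flows_caracol_iff[OF assms(1)]]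
  have "flow_lift n c t e = b e"
    using assms(3,1)
  proof (cases rule: caracol_cases)
    case (1 j) then show ?thesis using L(1) X by simp
  next
    case 2 then show ?thesis using L(2) B sum by simp
  next
    case (3 j) then show ?thesis using L(3) Y by metis
  next
    case (4 j)
    then have "b (j, j + 1) + b (j, n + 1) - inflow b j = c" using B by auto
    then show ?thesis using 4 L(4)[of j c t] X[of j] Y[of j] Y'[of j]
      by (auto simp: inflow_def simp del: One_nat_def Suc_eq_plus1)
  next
    case 5
    then show ?thesis using L(5)[of c t] B sum Y'[of n] by (auto simp: inflow_def)
  qed
  then show ?thesis by (simp add: t_def)
qed

lemma coords_flow_lift:
  assumes "n \<ge> 2" "t \<in> {..<2 * (n - 2)} \<rightarrow>\<^sub>E UNIV"
  shows "coords (2 * (n - 2)) (free_edge n) (restrict (flow_lift n c t) (caracol n)) = t"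
proof (rule PiE_ext[OF _ assms(2)])
  fix i assume i: "i \<in> {..<2 * (n - 2)}"
  have "flow_lift n c t (free_edge n i) = t i"
  proof (cases "even i")
    case True
    then obtain k where k: "i = 2 * k" by blast
    then show ?thesis
      using flow_lift_simps(1)[OF assms(1), of "n - 1 - k" c t] i by (simp add: free_edge_def)
  next
    case False
    then obtain k where k: "i = 2 * k + 1" by (rule oddE)
    moreover have "n - 1 - k + 1 = n - k" "n - 1 - (n - 1 - k) = k" using k i by auto
    ultimately show ?thesis
      using flow_lift_simps(3)[OF assms(1), of "n - 1 - k" c t] i False
      by (simp add: free_edge_def del: One_nat_def)
  qed
  then show "coords (2 * (n - 2)) (free_edge n) (restrict (flow_lift n c t) (caracol n)) i = t i"
    using i free_edge_in[of i n] by (simp add: coords_def)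
qed (simp add: coords_def)

text \<open>Solving for the other edges involves no division, so integral free coordinates give an
  integral flow when \<open>c\<close> is an integer.\<close>

lemma flow_lift_Ints:
  assumes "n \<ge> 2" "e \<in> caracol n" "c \<in> \<int>" and t: "t \<in> int_lattice {..<2 * (n - 2)}"
  shows "flow_lift n c t e \<in> \<int>"
proof -
  have X: "t (2 * (n - 1 - j)) \<in> \<int>" and Y: "t (2 * (n - 1 - j) + 1) \<in> \<int>"
    if "2 \<le> j" "j < n" for j
    using that by (auto intro!: PiE_mem[OF t])
  have Y': "t (2 * (n - j) + 1) \<in> \<int>" if "3 \<le> j" "j \<le> n" for j
    using Y[of "j - 1"] that by simp
  have S: "(\<Sum>l=2..<n. t (2 * (n - 1 - l))) \<in> \<int>"
    by (intro Ints_sum X) auto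
  note L = flow_lift_simps[OF assms(1)]
  show ?thesis using assms(2,1)
  proof (cases rule: caracol_cases)
    case (1 j) then show ?thesis using L(1) X by simp
  next
    case 2 then show ?thesis using L(2) S assms(3) by simp
  next
    case (3 j) then show ?thesis using L(3) Y by metis
  next
    case (4 j) then show ?thesis using L(4)[of j c t] X[of j] Y[of j] Y'[of j] assms(3)
      by (auto simp del: One_nat_def Suc_eq_plus1)
  next
    case 5 then show ?thesis using L(5)[of c t] S Y'[of n] assms(3) by auto
  qed
qed

text \<open>The free edges give the lower bounds, the edges \<open>(j, n + 1)\<close> the upper
  bounds on the path flows, and \<open>(1, n)\<close> the bound on the sum.\<close>

lemma flow_lift_nonneg_iff:
  assumes "n \<ge> 2"
  shows "(\<forall>e\<in>caracol n. 0 \<le> flow_lift n 1 t e) \<longleftrightarrow> region (n - 2) 0 1 t"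
proof -
  let ?X = "\<lambda>j. t (2 * (n - 1 - j))" and ?Y = "\<lambda>j. t (2 * (n - 1 - j) + 1)"
  let ?V = "\<lambda>j. 0 \<le> ?X j \<and> 0 \<le> ?Y j \<and> ?Y j \<le> 1 + ?X j + (if 3 \<le> j then t (2 * (n - j) + 1) else 0)"
  let ?S = "\<Sum>l=2..<n. ?X l"
  note L = flow_lift_simps[OF assms]
  have mem: "(1, n) \<in> caracol n"
    "2 \<le> j \<Longrightarrow> j < n \<Longrightarrow> (1, j) \<in> caracol n"
    "2 \<le> j \<Longrightarrow> j < n \<Longrightarrow> (j, j + 1) \<in> caracol n"
    "2 \<le> j \<Longrightarrow> j < n \<Longrightarrow> (j, n + 1) \<in> caracol n" for j
    using assms by (auto simp: caracol_def)
  have "(\<forall>e\<in>caracol n. 0 \<le> flow_lift n 1 t e) \<longleftrightarrow> (\<forall>j\<in>{2..<n}. ?V j) \<and> ?S \<le> 1"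
  proof safe
    assume *: "\<forall>e\<in>caracol n. 0 \<le> flow_lift n 1 t e"
    show "?S \<le> 1" using bspec[OF * mem(1)] L(2)[of 1 t] by simp
    fix j assume "j \<in> {2..<n}"
    then have j: "2 \<le> j" "j < n" by auto
    show "0 \<le> ?X j" "0 \<le> ?Y j" "?Y j \<le> 1 + ?X j + (if 3 \<le> j then t (2 * (n - j) + 1) else 0)"
      using bspec[OF * mem(2)[OF j]] bspec[OF * mem(3)[OF j]] bspec[OF * mem(4)[OF j]]
      unfolding L(1)[OF j] L(3)[OF j] L(4)[OF j] by auto
  next
    fix a b assume V: "\<forall>j\<in>{2..<n}. ?V j" and S: "?S \<le> 1" and e: "(a, b) \<in> caracol n"
    show "0 \<le> flow_lift n 1 t (a, b)"
      using e assms
    proof (cases rule: caracol_cases)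
      case (1 j) then show ?thesis using V L(1)[of j 1 t] by simp
    next
      case 2 then show ?thesis using L(2)[of 1 t] S by simp
    next
      case (3 j) then have "?V j" using V by auto
      then show ?thesis using 3 L(3)[of j 1 t] by simp
    next
      case (4 j) then have "?V j" using V by auto
      then show ?thesis using 4 L(4)[of j 1 t] by simp
    next
      case 5
      \<comment> \<open>The flow on the last edge is 2 minus a sum that is at most 1, plus a path
        flow if \<open>3 \<le> n\<close>, so it is nonnegative once that path flow is.\<close>
      have "0 \<le> t 1" if "3 \<le> n"
      proof -
        have "n - 1 \<in> {2..<n}" using that by auto
        then show ?thesis using bspec[OF V, of "n - 1"] by simp
      qed
      then show ?thesis using 5 L(5)[of 1 t] S by auto
    qed
  qed
  also have "?S = (\<Sum>k<n-2. t (2 * k))"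
    by (rule sum.reindex_bij_witness[of _ "\<lambda>k. n - 1 - k" "\<lambda>l. n - 1 - l"]) auto
  also have "(\<forall>j\<in>{2..<n}. ?V j) \<longleftrightarrow> (\<forall>k<n-2. 0 \<le> t (2*k) \<and> 0 \<le> t (2*k+1) \<and>
       t (2*k+1) \<le> 1 + t (2*k) + (if Suc k = n - 2 then 0 else t (2*k+3)))" (is "_ \<longleftrightarrow> (\<forall>k<n-2. ?W k)")
  proof -
    \<comment> \<open>Vertex \<open>j\<close> corresponds to \<open>k = n - 1 - j\<close>. Vertex 2,
      which has no incoming path flow, is the top index \<open>k = n - 3\<close>; this explains the
      0 in \<open>?W\<close>.\<close>
    have VW: "?V (n - 1 - k) \<longleftrightarrow> ?W k" if "k < n - 2" for k
    proof -
      have "n - 1 - (n - 1 - k) = k" "2 * (n - (n - 1 - k)) + 1 = 2 * k + 3" "3 \<le> n - 1 - k \<longleftrightarrow> Suc k \<noteq> n - 2"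
        using that by auto
      then show ?thesis by (simp only: if_not_P) auto
    qed
    show ?thesis
    proof (intro iffI allI impI ballI)
      fix k assume V: "\<forall>j\<in>{2..<n}. ?V j" and k: "k < n - 2"
      have "n - 1 - k \<in> {2..<n}" using k by auto
      from bspec[OF V this] show "?W k" unfolding VW[OF k] .
    next
      fix j assume W: "\<forall>k<n-2. ?W k" and j: "j \<in> {2..<n}"
      obtain k where k: "k < n - 2" "j = n - 1 - k"
        using j that[of "n - 1 - j"] by auto
      show "?V j" unfolding k(2) VW[OF k(1)] using W k(1) by blast
    qed
  qed
  finally show ?thesis by (simp add: region_iff)
qed

theorem theorem5p10:
  fixes n :: nat
  assumes "n \<ge> 2"
  shows "flow_polytope_volume n (caracol n) (\<lambda>_. 1) = catalan (n - 2) * real n ^ (n - 2)"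
proof -
  let ?E = "caracol n"
  define N where "N = n - 2"
  define d where "d = 2 * N"
  define A where "A = const_flows n ?E 1"
  define P where "P = {b \<in> A. \<forall>e\<in>?E. b e \<ge> 0}"
  have n: "n = N + 2" using assms by (simp add: N_def)
  have A: "flow_space n ?E (\<lambda>_. 1) = A" by (simp add: flow_space_def A_def const_flows_def)
  have A_ne: "A \<noteq> {}" using flow_lift_in[OF assms, of 1] by (auto simp: A_def)
  have L: "direction_space ?E A = const_flows n ?E 0"
    unfolding A_def by (rule direction_space_const_flows) (use A_ne in \<open>simp add: A_def\<close>)
  note lift = flow_lift_in[OF assms] and lift_coords = flow_lift_coords[OF assms, folded N_def, folded d_def]
    and coords_lift = coords_flow_lift[OF assms, folded N_def, folded d_def]
  \<comment> \<open>A flow is the lift of its coordinates, so nonnegativity on all edges becomes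
    membership in the region with path inflow 0 and supply 1.\<close>
  have image: "coords d (free_edge n) ` P = {t \<in> {..<2 * N} \<rightarrow>\<^sub>E UNIV. region N 0 1 t}"
  proof (intro equalityI subsetI)
    fix t assume "t \<in> coords d (free_edge n) ` P"
    then obtain b where b: "b \<in> P" "t = coords d (free_edge n) b" by blast
    then have "\<forall>e\<in>?E. 0 \<le> flow_lift n 1 t e" using lift_coords[of b 1] by (auto simp: P_def A_def)
    then show "t \<in> {t \<in> {..<2 * N} \<rightarrow>\<^sub>E UNIV. region N 0 1 t}"
      using flow_lift_nonneg_iff[OF assms, of t] b(2) by (simp add: N_def coords_def d_def)
  next
    fix t assume t: "t \<in> {t \<in> {..<2 * N} \<rightarrow>\<^sub>E UNIV. region N 0 1 t}"
    then have "restrict (flow_lift n 1 t) ?E \<in> P"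
      using flow_lift_nonneg_iff[OF assms, of t] lift[of 1 t] by (simp add: P_def A_def N_def)
    moreover have "t = coords d (free_edge n) (restrict (flow_lift n 1 t) ?E)"
      using coords_lift[of t 1] t by (simp add: d_def)
    ultimately show "t \<in> coords d (free_edge n) ` P" by blast
  qed
  have "lattice_volume ?E d A P = measure (leb {..<d}) (coords d (free_edge n) ` P)"
  proof (rule lattice_volume_coordinates[OF A_ne], unfold L)
    show "A \<subseteq> extensional ?E" by (auto simp: A_def const_flows_def PiE_def)
    show "P \<subseteq> A" by (auto simp: P_def)
    show "free_edge n i \<in> ?E" if "i < d" for i
      using free_edge_in[of i n] that by (simp add: d_def N_def)
    show "(\<lambda>e\<in>?E. p e + x e) \<in> A" if "p \<in> A" "x \<in> const_flows n ?E 0" for p x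
      using that by (simp add: A_def const_flows_def net_flow_add)
    show "lin_comb ?E d c x \<in> const_flows n ?E 0" if "\<And>i. i < d \<Longrightarrow> x i \<in> const_flows n ?E 0" for c x
      using that by (simp add: const_flows_def net_flow_lin_comb) (simp add: lin_comb_def)
    show "bij_betw (coords d (free_edge n)) (const_flows n ?E 0) ({..<d} \<rightarrow>\<^sub>E UNIV)"
    proof (rule bij_betw_byWitness[where f' = "\<lambda>t. restrict (flow_lift n 0 t) ?E"])
      show "\<forall>b\<in>const_flows n ?E 0. restrict (flow_lift n 0 (coords d (free_edge n) b)) ?E = b"
      proof
        fix b assume b: "b \<in> const_flows n ?E 0"
        then have "b \<in> ?E \<rightarrow>\<^sub>E UNIV" by (simp add: const_flows_def)
        then show "restrict (flow_lift n 0 (coords d (free_edge n) b)) ?E = b"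
          by (intro PiE_ext[of _ ?E "\<lambda>_. UNIV"]) (simp_all add: lift_coords[OF b])
      qed
      show "coords d (free_edge n) ` const_flows n ?E 0 \<subseteq> {..<d} \<rightarrow>\<^sub>E UNIV"
        by (rule image_subsetI) (simp add: coords_def)
    qed (use lift coords_lift in auto)
    show "x e \<in> \<int>" if "x \<in> const_flows n ?E 0" "coords d (free_edge n) x \<in> int_lattice {..<d}" "e \<in> ?E" for x e
      using flow_lift_Ints[OF assms that(3) Ints_0 that(2)[unfolded d_def N_def]] lift_coords[OF that(1,3)]
      by (simp add: d_def N_def)
    have "{t \<in> space (leb {..<2*N}). region N 0 1 t} \<in> sets (leb {..<2*N})"
      using measurable_region[of N "{..<2*N}" "\<lambda>_. 0" "\<lambda>_. 1"] by (simp add: pred_def)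
    then show "coords d (free_edge n) ` P \<in> sets (leb {..<d})"
      unfolding image by (simp add: d_def space_leb)
  qed
  also have "\<dots> = region_vol N 0 1"
    unfolding image using emeasure_region[of 0 1 N]
    by (simp add: d_def measure_def region_vol_nonneg)
  finally have vol: "lattice_volume ?E d A P = region_vol N 0 1" .
  have dim: "card ?E - n = d" unfolding card_caracol[OF assms] d_def using n by simp
  have "flow_polytope_volume n ?E (\<lambda>_. 1) = fact (2 * N) * region_vol N 0 1"
    using vol by (simp add: flow_polytope_volume_def normalized_volume_def A flow_polytope_def P_def dim d_def)
  \<comment> \<open>At \<open>y = 0\<close> and \<open>r = 1\<close> the volume is
    \<open>(N + 2) ^ N / (fact N * fact (N + 1))\<close>. Here \<open>N + 2 = n\<close>, and
    \<open>fact (2 * N)\<close> completes the Catalan number.\<close>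
  also have "\<dots> = catalan N * real n ^ N"
    by (simp add: region_vol_def catalan_def binomial_fact n field_simps)
  finally show ?thesis by (simp add: N_def)
qed

end
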